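(* Let $\Lambda$ be a closed approximate subgroup of $\mathbb R^d$. Then there exist a vector subspace $V_o\subset\mathbb R^d$, a supplementary subspace $V_d$ of $V_o$ in $\mathbb R^d$ (i.e. $V_o\oplus V_d=\mathbb R^d$), a uniformly discrete approximate subgroup $\Lambda_d\subset V_d$ and a compact approximate subgroup $K_e\subset V_d$ such that $\Lambda$ is commensurable to $V_o+\Lambda_d+K_e$.
   Context: An approximate subgroup of an abelian group $G$ (written additively) is a subset $\Lambda\subset G$ with $\Lambda=-\Lambda$, $0\in\Lambda$ and $\Lambda+\Lambda\subset F+\Lambda$ for some finite $F\subset G$. Two subsets $X,Y\subset G$ are commensurable if there is a finite $F\subset G$ with $X\subset F+Y$ and $Y\subset F+X$. A subset $X$ is uniformly discrete if $0$ is isolated in $X-X$. *)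

theory Defs
  imports "HOL-Analysis.Analysis" "HOL-Library.Set_Algebras"
begin

text \<open>Sums of sets are the pointwise (Minkowski) sums of \<^theory>\<open>HOL-Library.Set_Algebras\<close>.\<close>

definition approximate_subgroup :: "'a::ab_group_add set \<Rightarrow> bool" where
  "approximate_subgroup \<Lambda> \<longleftrightarrow>
     \<Lambda> = uminus ` \<Lambda> \<and> 0 \<in> \<Lambda> \<and> (\<exists>F. finite F \<and> \<Lambda> + \<Lambda> \<subseteq> F + \<Lambda>)"

text \<open>
  For \<^term>\<open>\<Lambda>\<close> contained in a subgroup, it makes no difference whether \<^term>\<open>F\<close> is taken in that
  subgroup or in the whole group.
\<close>

lemma approximate_subgroup_finite_subset:
  fixes \<Lambda> H :: "'a::ab_group_add set"
  assumes "approximate_subgroup \<Lambda>" "\<Lambda> \<subseteq> H"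
    and diff: "\<And>x y. x \<in> H \<Longrightarrow> y \<in> H \<Longrightarrow> x - y \<in> H"
  shows "\<exists>F. finite F \<and> F \<subseteq> H \<and> \<Lambda> + \<Lambda> \<subseteq> F + \<Lambda>"
proof -
  obtain F where F: "finite F" "\<Lambda> + \<Lambda> \<subseteq> F + \<Lambda>" and "0 \<in> \<Lambda>"
    using assms(1) unfolding approximate_subgroup_def by blast
  have "\<Lambda> + \<Lambda> \<subseteq> (F \<inter> H) + \<Lambda>"
  proof
    fix z assume z: "z \<in> \<Lambda> + \<Lambda>"
    then obtain f l where fl: "z = f + l" "f \<in> F" "l \<in> \<Lambda>"
      using F(2) by (blast elim: set_plus_elim)
    obtain a b where ab: "z = a + b" "a \<in> \<Lambda>" "b \<in> \<Lambda>"
      using z by (blast elim: set_plus_elim)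
    have "0 - b \<in> H"
      using \<open>0 \<in> \<Lambda>\<close> ab(3) assms(2) by (blast intro: diff)
    then have "a - (0 - b) - l \<in> H"
      using ab(2) fl(3) assms(2) by (blast intro: diff)
    moreover have "a - (0 - b) - l = f"
      using ab(1) fl(1) by (simp add: algebra_simps)
    ultimately show "z \<in> (F \<inter> H) + \<Lambda>"
      using fl by (auto intro: set_plus_intro)
  qed
  with F(1) show ?thesis
    by (intro exI[of _ "F \<inter> H"]) auto
qed

definition commensurable :: "'a::ab_group_add set \<Rightarrow> 'a set \<Rightarrow> bool" where
  "commensurable X Y \<longleftrightarrow> (\<exists>F. finite F \<and> X \<subseteq> F + Y \<and> Y \<subseteq> F + X)"

definition uniformly_discrete :: "'a::real_normed_vector set \<Rightarrow> bool" where
  "uniformly_discrete X \<longleftrightarrow> 0 isolated_in {x - y |x y. x \<in> X \<and> y \<in> X}"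

lemma uniformly_discrete_iff_uniform_discrete:
  fixes X :: "'a::real_normed_vector set"
  assumes "X \<noteq> {}"
  shows "uniformly_discrete X \<longleftrightarrow> uniform_discrete X"
proof
  assume "uniformly_discrete X"
  then obtain T where T: "open T" "T \<inter> {x - y |x y. x \<in> X \<and> y \<in> X} = {0}"
    unfolding uniformly_discrete_def isolated_in_def by blast
  then obtain e where e: "e > 0" "\<And>z. dist z 0 < e \<Longrightarrow> z \<in> T"
    unfolding open_dist by blast
  have "x = y" if "x \<in> X" "y \<in> X" "dist x y < e" for x y
  proof -
    have "x - y \<in> T" using e(2) that(3) by (simp add: dist_norm)
    then have "x - y \<in> {0}" using T(2) that by blast
    then show ?thesis by simp
  qed
  with e(1) show "uniform_discrete X" unfolding uniform_discrete_def by blast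
next
  assume "uniform_discrete X"
  then obtain e where e: "e > 0" "\<And>x y. x \<in> X \<Longrightarrow> y \<in> X \<Longrightarrow> dist x y < e \<Longrightarrow> x = y"
    unfolding uniform_discrete_def by blast
  have 0: "0 \<in> {x - y |x y. x \<in> X \<and> y \<in> X}" using assms by force
  moreover have "ball 0 e \<inter> {x - y |x y. x \<in> X \<and> y \<in> X} = {0}"
    using e 0 by (auto simp: dist_norm norm_minus_commute)
  ultimately show "uniformly_discrete X"
    unfolding uniformly_discrete_def isolated_in_def by blast
qed

definition supplementary_subspaces :: "'a::real_vector set \<Rightarrow> 'a set \<Rightarrow> bool" where
  "supplementary_subspaces V W \<longleftrightarrow>
     subspace V \<and> subspace W \<and> V \<inter> W = {0} \<and> V + W = UNIV"

end

theory Submission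
  imports Defs
begin

text \<open>
  Since \<open>\<Lambda>\<close> is closed and every \<open>n\<Lambda>\<close> is covered by finitely many translates of \<open>\<Lambda>\<close>, all the sets
  \<open>n\<Lambda>\<close> with \<open>n \<ge> 2\<close> coincide near \<open>0\<close> with \<open>\<Lambda> + \<Lambda>\<close>. Hence \<open>\<Lambda> + \<Lambda>\<close> is a closed local subgroup
  and, as in the closed subgroup theorem, it agrees near \<open>0\<close> with a subspace \<open>W\<close>. For \<open>K\<^sub>e\<close> take
  a small ball of \<open>W\<close>, and let \<open>\<Lambda>\<^sub>d\<close> consist of those points of \<open>4\<Lambda>\<close> whose orthogonal projection
  to \<open>W\<close> lies in a fine lattice of \<open>W\<close>. As vector spaces are themselves sums of a lattice and a
  compact set, \<open>V\<^sub>o = {0}\<close> and \<open>V\<^sub>d = UNIV\<close> suffice.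
\<close>

section \<open>Covering by finitely many translates\<close>

text \<open>One half of \<open>commensurable\<close>, isolated as a transitive relation compatible
  with sums.\<close>

definition finitely_covered :: "'a::ab_group_add set \<Rightarrow> 'a set \<Rightarrow> bool" where
  "finitely_covered X Y \<longleftrightarrow> (\<exists>F. finite F \<and> X \<subseteq> F + Y)"

lemma finitely_covered_plus:
  assumes "finitely_covered X A" "finitely_covered Y B"
  shows "finitely_covered (X + Y) (A + B)"
proof -
  obtain F G where FG: "finite F" "finite G" "X \<subseteq> F + A" "Y \<subseteq> G + B"
    using assms unfolding finitely_covered_def by blast
  have "X + Y \<subseteq> (F + A) + (G + B)"
    using FG(3,4) by (rule set_plus_mono2)
  also have "\<dots> = (F + G) + (A + B)"
    by (simp add: ac_simps)
  finally show ?thesis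
    unfolding finitely_covered_def using FG(1,2) by (blast intro: finite_set_plus)
qed

lemma finitely_covered_trans:
  assumes "finitely_covered X Y" "finitely_covered Y Z"
  shows "finitely_covered X Z"
proof -
  obtain F G where FG: "finite F" "finite G" "X \<subseteq> F + Y" "Y \<subseteq> G + Z"
    using assms unfolding finitely_covered_def by blast
  have "F + Y \<subseteq> F + (G + Z)"
    using FG(4) by (intro set_plus_mono2) auto
  then have "X \<subseteq> (F + G) + Z"
    using FG(3) by (simp add: add.assoc)
  then show ?thesis
    unfolding finitely_covered_def using FG(1,2) by (blast intro: finite_set_plus)
qed

lemma finitely_covered_mono:
  "finitely_covered X Y \<Longrightarrow> X' \<subseteq> X \<Longrightarrow> Y \<subseteq> Y' \<Longrightarrow> finitely_covered X' Y'"
  unfolding finitely_covered_def by (meson order_refl order_trans set_plus_mono2)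

text \<open>The intermediate set is \<open>\<Lambda> + \<Lambda>\<close>. Iteration covers every
  finite sum of copies of \<open>\<Lambda>\<close>.\<close>

lemma finitely_covered_sums:
  assumes "finitely_covered (\<Lambda> + \<Lambda>) \<Lambda>" "finitely_covered X \<Lambda>" "finitely_covered Y \<Lambda>"
  shows "finitely_covered (X + Y) \<Lambda>"
  using assms finitely_covered_plus finitely_covered_trans by blast

lemma finitely_covered_Int_subgroup:
  assumes "finitely_covered X Y"
    and diff: "\<And>x y. x \<in> G \<Longrightarrow> y \<in> G \<Longrightarrow> x - y \<in> G"
  shows "finitely_covered (X \<inter> G) ((Y + uminus ` Y) \<inter> G)"
proof -
  obtain F where F: "finite F" "X \<subseteq> F + Y"
    using assms unfolding finitely_covered_def by blast
  define e where "e f = (SOME z. z \<in> ({f} + Y) \<inter> G)" for f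
  have "x \<in> e ` F + (Y + uminus ` Y) \<inter> G" if x: "x \<in> X" "x \<in> G" for x
  proof -
    obtain f y where fy: "x = f + y" "f \<in> F" "y \<in> Y"
      using F(2) x(1) by (blast elim: set_plus_elim)
    then have "x \<in> ({f} + Y) \<inter> G"
      using x(2) by auto
    then have e: "e f \<in> ({f} + Y) \<inter> G"
      unfolding e_def by (rule someI)
    then obtain y' where y': "e f = f + y'" "y' \<in> Y"
      by (auto elim: set_plus_elim)
    have eq: "x - e f = y + - y'"
      by (simp add: fy(1) y'(1))
    have "x - e f \<in> Y + uminus ` Y"
      unfolding eq using fy(3) y'(2) by (intro set_plus_intro imageI)
    moreover have "x - e f \<in> G"
      using diff[OF x(2)] e by blast
    ultimately have "x - e f \<in> (Y + uminus ` Y) \<inter> G"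
      by blast
    then have "e f + (x - e f) \<in> e ` F + (Y + uminus ` Y) \<inter> G"
      using fy(2) by blast
    then show ?thesis
      by simp
  qed
  then show ?thesis
    unfolding finitely_covered_def using F(1) by (intro exI[of _ "e ` F"]) auto
qed

lemma uminus_set_plus:
  fixes X Y :: "'a::ab_group_add set"
  assumes "\<And>x. x \<in> X \<Longrightarrow> - x \<in> X" "\<And>y. y \<in> Y \<Longrightarrow> - y \<in> Y" "z \<in> X + Y"
  shows "- z \<in> X + Y"
proof -
  obtain x y where "z = x + y" "x \<in> X" "y \<in> Y"
    using assms(3) by (blast elim: set_plus_elim)
  then have "- z = - x + - y" "- x \<in> X" "- y \<in> Y"
    using assms(1,2) by auto
  then show ?thesis
    by (metis set_plus_intro)
qed

section \<open>Closed sets and behaviour near 0\<close>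

lemma closed_finite_set_plus:
  fixes Y :: "'a::real_normed_vector set"
  assumes "finite F" "closed Y"
  shows "closed (F + Y)"
proof -
  have "F + Y = (\<Union>f\<in>F. (\<lambda>y. f + y) ` Y)"
    by (auto simp: set_plus_def)
  then show ?thesis
    using assms by (auto intro!: closed_translation)
qed

lemma finitely_covered_closure:
  fixes Y :: "'a::real_normed_vector set"
  assumes "finitely_covered X Y" "closed Y"
  shows "finitely_covered (closure X) Y"
  using assms unfolding finitely_covered_def
  by (meson closed_finite_set_plus closure_minimal)

text \<open>A translate \<open>f + \<Lambda>\<close> accumulating at \<open>0\<close> contains \<open>0\<close>, so that \<open>f \<in> - \<Lambda> = \<Lambda>\<close>.\<close>

lemma finitely_covered_near_0:
  fixes \<Lambda> :: "'a::real_normed_vector set"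
  assumes "closed \<Lambda>" "\<Lambda> = uminus ` \<Lambda>" "finitely_covered X \<Lambda>"
  shows "\<exists>\<eta>>0. X \<inter> ball 0 \<eta> \<subseteq> \<Lambda> + \<Lambda>"
proof -
  obtain F where F: "finite F" "X \<subseteq> F + \<Lambda>"
    using assms(3) unfolding finitely_covered_def by blast
  \<comment> \<open>By symmetry of \<open>\<Lambda>\<close>, these \<open>f\<close> are the ones
    whose translate \<open>f + \<Lambda>\<close> avoids 0. Their finite union is closed, so it also
    avoids a ball around 0.\<close>
  define F' where "F' = {f\<in>F. f \<notin> \<Lambda>}"
  have "closed (F' + \<Lambda>)"
    using F(1) assms(1) by (auto simp: F'_def intro: closed_finite_set_plus)
  moreover have "0 \<notin> F' + \<Lambda>"
  proof
    assume "0 \<in> F' + \<Lambda>"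
    then obtain f l where fl: "0 = f + l" "f \<in> F'" "l \<in> \<Lambda>"
      by (blast elim: set_plus_elim)
    then have "f = - l"
      by (simp add: eq_neg_iff_add_eq_0)
    then have "f \<in> \<Lambda>"
      using fl(3) assms(2) by blast
    then show False
      using fl(2) by (simp add: F'_def)
  qed
  ultimately obtain \<eta> where \<eta>: "\<eta> > 0" "ball 0 \<eta> \<subseteq> - (F' + \<Lambda>)"
    by (metis ComplI open_Compl open_contains_ball)
  have "x \<in> \<Lambda> + \<Lambda>" if x: "x \<in> X" "x \<in> ball 0 \<eta>" for x
  proof -
    obtain f l where fl: "x = f + l" "f \<in> F" "l \<in> \<Lambda>"
      using F(2) x(1) by (blast elim: set_plus_elim)
    have "x \<notin> F' + \<Lambda>"
      using \<eta>(2) x(2) by blast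
    then have "f \<in> \<Lambda>"
      using fl by (auto simp: F'_def)
    then show ?thesis
      using fl by auto
  qed
  then show ?thesis
    using \<eta>(1) by blast
qed

section \<open>Local subgroups of Euclidean space\<close>

text \<open>The smaller multiples of \<open>x\<close> are no longer than the last one, so adding
  \<open>x\<close> repeatedly never leaves the ball in which \<open>S\<close> is closed under
  addition.\<close>

lemma local_subgroup_multiples:
  fixes x :: "'a::real_normed_vector"
  assumes "0 \<in> S" "(S + S) \<inter> ball 0 \<eta> \<subseteq> S" "x \<in> S" "norm (real n *\<^sub>R x) < \<eta>"
  shows "real n *\<^sub>R x \<in> S"
  using assms(4)
proof (induction n)
  case 0
  then show ?case
    using assms(1) by simp
next
  case (Suc n)
  have "norm (real n *\<^sub>R x) \<le> norm (real (Suc n) *\<^sub>R x)"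
    by (simp add: mult_right_mono)
  then have "real n *\<^sub>R x \<in> S"
    using Suc by linarith
  moreover have "real (Suc n) *\<^sub>R x = real n *\<^sub>R x + x"
    by (simp add: algebra_simps)
  ultimately have "real (Suc n) *\<^sub>R x \<in> S + S"
    using assms(3) by (metis set_plus_intro)
  then show ?case
    using Suc.prems assms(2) by (auto simp: dist_norm)
qed

text \<open>If \<open>S\<close> were not inside \<open>W\<close> near 0, it would contain
  arbitrarily short nonzero vectors orthogonal to \<open>W\<close>. Multiples of these approximate a
  whole segment in a limit direction, which therefore belongs to \<open>W\<close> and yet is
  orthogonal to \<open>W\<close>.\<close>

lemma closed_local_subgroup:
  fixes S :: "'a::euclidean_space set"
  assumes "\<eta> > 0" "0 \<in> S" and sym: "\<And>x. x \<in> S \<Longrightarrow> - x \<in> S"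
    and closed: "closure S \<inter> ball 0 \<eta> \<subseteq> S"
    and plus: "(S + S) \<inter> ball 0 \<eta> \<subseteq> S"
  shows "\<exists>W. subspace W \<and> W \<inter> ball 0 \<eta> \<subseteq> S \<and> (\<exists>\<rho>>0. S \<inter> ball 0 \<rho> \<subseteq> W)"
proof -
  \<comment> \<open>The directions whose line stays in \<open>S\<close> throughout the ball: the
    analogue of the Lie algebra.\<close>
  define W where "W = {w. \<forall>t. norm (t *\<^sub>R w) < \<eta> \<longrightarrow> t *\<^sub>R w \<in> S}"
  have "subspace W"
  proof (rule subspaceI)
    show "0 \<in> W"
      using assms by (simp add: W_def)
  next
    fix c :: real and w
    assume "w \<in> W"
    then show "c *\<^sub>R w \<in> W"
      unfolding W_def mem_Collect_eq by (metis scaleR_scaleR)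
  next
    fix v w
    assume vw: "v \<in> W" "w \<in> W"
    have "t *\<^sub>R (v + w) \<in> S" if t: "norm (t *\<^sub>R (v + w)) < \<eta>" for t
    proof -
      \<comment> \<open>Division by a large \<open>Suc n\<close> makes both summands and their sum
        short enough to be added inside \<open>S\<close>; multiplying back is
        \<open>local_subgroup_multiples\<close>.\<close>
      obtain n where n: "real (Suc n) > (norm (t *\<^sub>R v) + norm (t *\<^sub>R w)) / \<eta>"
        by (meson less_trans lessI of_nat_less_iff reals_Archimedean2)
      define s where "s = t / real (Suc n)"
      have "norm (t *\<^sub>R v) + norm (t *\<^sub>R w) < real (Suc n) * \<eta>"
        using n assms(1) by (simp add: field_simps)
      then have "(norm (t *\<^sub>R v) + norm (t *\<^sub>R w)) / real (Suc n) < \<eta>"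
        by (simp add: pos_divide_less_eq mult.commute del: of_nat_Suc)
      then have sum: "norm (s *\<^sub>R v) + norm (s *\<^sub>R w) < \<eta>"
        by (simp add: s_def add_divide_distrib del: of_nat_Suc)
      then have "s *\<^sub>R v \<in> S" "s *\<^sub>R w \<in> S"
        using vw norm_ge_zero[of "s *\<^sub>R v"] norm_ge_zero[of "s *\<^sub>R w"]
        unfolding W_def by (smt (verit) mem_Collect_eq)+
      then have "s *\<^sub>R v + s *\<^sub>R w \<in> S + S"
        by (rule set_plus_intro)
      moreover have "norm (s *\<^sub>R v + s *\<^sub>R w) < \<eta>"
        using sum norm_triangle_ineq[of "s *\<^sub>R v" "s *\<^sub>R w"] by linarith
      ultimately have "s *\<^sub>R v + s *\<^sub>R w \<in> S"
        using plus by auto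
      moreover have eq: "real (Suc n) *\<^sub>R (s *\<^sub>R v + s *\<^sub>R w) = t *\<^sub>R (v + w)"
        unfolding s_def by (simp add: scaleR_add_right[symmetric] del: of_nat_Suc)
      ultimately show ?thesis
        using local_subgroup_multiples[OF assms(2) plus] t by metis
    qed
    then show "v + w \<in> W"
      by (simp add: W_def)
  qed
  moreover have WS: "W \<inter> ball 0 \<eta> \<subseteq> S"
  proof
    fix w assume "w \<in> W \<inter> ball 0 \<eta>"
    then have "1 *\<^sub>R w \<in> S"
      unfolding W_def by (auto simp: dist_norm simp del: scaleR_one dest: spec[of _ 1])
    then show "w \<in> S"
      by simp
  qed
  moreover have "\<exists>\<rho>>0. S \<inter> ball 0 \<rho> \<subseteq> W"
  proof (rule ccontr)
    assume contra: "\<not> ?thesis"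
    \<comment> \<open>Take a short point of \<open>S\<close> outside \<open>W\<close> and subtract
      its component in \<open>W\<close>. By Pythagoras neither component is longer than the point,
      so everything stays in the ball.\<close>
    have "\<exists>v\<in>S. v \<noteq> 0 \<and> norm v < \<epsilon> \<and> (\<forall>w\<in>W. orthogonal v w)" if "\<epsilon> > 0" for \<epsilon>
    proof -
      define \<delta> where "\<delta> = min \<epsilon> \<eta>"
      have "\<delta> > 0"
        using that assms(1) by (simp add: \<delta>_def)
      then obtain x where x: "x \<in> S" "norm x < \<delta>" "x \<notin> W"
        using contra by (auto simp: subset_iff)
      obtain w v where wv: "w \<in> span W" "\<And>u. u \<in> span W \<Longrightarrow> orthogonal v u" "x = w + v"
        using orthogonal_subspace_decomp_exists[of W x] by metis
      have w: "w \<in> W"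
        using wv(1) \<open>subspace W\<close> span_minimal[of W W] by blast
      have "orthogonal w v"
        using wv(1,2) orthogonal_commute by blast
      then have "norm x ^ 2 = norm w ^ 2 + norm v ^ 2"
        unfolding wv(3) by (rule norm_add_Pythagorean)
      then have "norm w ^ 2 \<le> norm x ^ 2" "norm v ^ 2 \<le> norm x ^ 2"
        by auto
      then have norms: "norm w \<le> norm x" "norm v \<le> norm x"
        by (auto intro: power2_le_imp_le)
      have "- w \<in> S"
        using WS w x(2) norms(1) by (auto simp: dist_norm \<delta>_def intro!: sym)
      then have "x + - w \<in> S + S"
        using x(1) by (intro set_plus_intro)
      then have "v \<in> S + S"
        by (simp add: wv(3))
      then have "v \<in> S"
        using plus x(2) norms(2) by (auto simp: dist_norm \<delta>_def)
      moreover have "v \<noteq> 0"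
        using x(3) w wv(3) by auto
      moreover have "norm v < \<epsilon>"
        using x(2) norms(2) by (simp add: \<delta>_def)
      ultimately show ?thesis
        using wv(2) span_base by blast
    qed
    then have "\<exists>v\<in>S. v \<noteq> 0 \<and> norm v < inverse (real (Suc n)) \<and> (\<forall>w\<in>W. orthogonal v w)" for n
      by simp
    then obtain v where v: "\<And>n. v n \<in> S" "\<And>n. v n \<noteq> 0"
      "\<And>n. norm (v n) < inverse (real (Suc n))" "\<And>n w. w \<in> W \<Longrightarrow> orthogonal (v n) w"
      by metis
    have v0: "(\<lambda>n. norm (v n)) \<longlonglongrightarrow> 0"
      by (rule tendsto_sandwich[OF _ _ tendsto_const LIMSEQ_inverse_real_of_nat])
        (use v(3) in \<open>auto intro!: always_eventually less_imp_le simp del: of_nat_Suc\<close>)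
    have "\<forall>n. sgn (v n) \<in> sphere 0 1"
      using v(2) by (simp add: norm_sgn)
    then obtain u r where u: "u \<in> sphere 0 1" "strict_mono r" "((\<lambda>n. sgn (v n)) \<circ> r) \<longlonglongrightarrow> u"
      using compact_sphere[of "0::'a" 1] unfolding compact_def by meson
    have v0r: "(\<lambda>n. norm (v (r n))) \<longlonglongrightarrow> 0"
      using LIMSEQ_subseq_LIMSEQ[OF v0 u(2)] by (simp add: o_def)
    have pos: "t *\<^sub>R u \<in> S" if t: "0 \<le> t" "t < \<eta>" for t
    proof -
      \<comment> \<open>Rounding down keeps the multiples of \<open>v (r n)\<close> at norm at most
        \<open>t < \<eta>\<close>, hence in \<open>S\<close>, while they still converge to
        \<open>t *\<^sub>R u\<close> because the \<open>v (r n)\<close> shrink to 0.\<close>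
      define k where "k n = nat \<lfloor>t / norm (v (r n))\<rfloor>" for n
      have k: "real (k n) \<le> t / norm (v (r n))" "t / norm (v (r n)) < real (k n) + 1" for n
        using t(1) by (auto simp: k_def of_nat_nat)
      have pos_norm: "norm (v (r n)) > 0" for n
        using v(2) by simp
      have upper: "real (k n) * norm (v (r n)) \<le> t" for n
        using k(1)[of n] pos_norm[of n] by (simp add: field_simps)
      have lower: "t - norm (v (r n)) \<le> real (k n) * norm (v (r n))" for n
        using k(2)[of n] pos_norm[of n] by (simp add: field_simps)
      have "(\<lambda>n. t - norm (v (r n))) \<longlonglongrightarrow> t - 0"
        by (intro tendsto_intros v0r)
      then have "(\<lambda>n. real (k n) * norm (v (r n))) \<longlonglongrightarrow> t"
        using tendsto_sandwich[OF always_eventually always_eventually, of "\<lambda>n. t - norm (v (r n))"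
            "\<lambda>n. real (k n) * norm (v (r n))" "\<lambda>_. t"] lower upper by simp
      from tendsto_scaleR[OF this u(3)]
      have "(\<lambda>n. real (k n) *\<^sub>R v (r n)) \<longlonglongrightarrow> t *\<^sub>R u"
        using pos_norm by (simp add: o_def sgn_div_norm mult.assoc)
      moreover have "real (k n) *\<^sub>R v (r n) \<in> S" for n
        using upper[of n] t(2) by (intro local_subgroup_multiples[OF assms(2) plus v(1)]) simp
      ultimately have "t *\<^sub>R u \<in> closure S"
        unfolding closure_sequential by (intro exI[of _ "\<lambda>n. real (k n) *\<^sub>R v (r n)"]) simp
      then show ?thesis
        using closed t u(1) by (auto simp: dist_norm)
    qed
    have "t *\<^sub>R u \<in> S" if "norm (t *\<^sub>R u) < \<eta>" for t
    proof (cases "t \<ge> 0")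
      case True
      then show ?thesis
        using pos that u(1) by simp
    next
      case False
      then have "(- t) *\<^sub>R u \<in> S"
        using that u(1) by (intro pos) auto
      then show ?thesis
        using sym by fastforce
    qed
    then have "u \<in> W"
      by (simp add: W_def)
    \<comment> \<open>Each \<open>v n\<close> is orthogonal to \<open>W\<close>, hence to
      \<open>u\<close>; in the limit the unit vector \<open>u\<close> is orthogonal to
      itself.\<close>
    then have "sgn (v n) \<bullet> u = 0" for n
      using v(4) by (simp add: sgn_div_norm orthogonal_def)
    then have "(\<lambda>n. 0) \<longlonglongrightarrow> u \<bullet> u"
      using tendsto_inner[OF u(3) tendsto_const[of u]] by (simp add: o_def)
    then have "u \<bullet> u = 0"
      by (simp add: LIMSEQ_const_iff)
    then show False
      using u(1) by simp
  qed
  ultimately show ?thesis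
    by blast
qed

section \<open>Balls and lattices in a subspace\<close>

text \<open>Compactness gives a finite cover by balls of radius \<open>r\<close>; choosing the
  centres in \<open>W\<close> keeps the differences in \<open>W\<close>.\<close>

lemma subspace_cball_finitely_covered:
  fixes W :: "'a::euclidean_space set"
  assumes "subspace W" "r > 0"
  shows "finitely_covered (W \<inter> cball 0 R) (W \<inter> cball 0 r)"
proof -
  have "compact (W \<inter> cball 0 R)"
    using assms(1) by (simp add: closed_Int_compact closed_subspace)
  then obtain F where F: "finite F" "F \<subseteq> W \<inter> cball 0 R" "W \<inter> cball 0 R \<subseteq> (\<Union>f\<in>F. ball f r)"
    using assms(2) by (elim compactE_image[where C = "W \<inter> cball 0 R" and f = "\<lambda>x. ball x r"]) auto
  have "x \<in> F + W \<inter> cball 0 r" if x: "x \<in> W \<inter> cball 0 R" for x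
  proof -
    obtain f where f: "f \<in> F" "x \<in> ball f r"
      using F(3) x by blast
    have "x - f \<in> W \<inter> cball 0 r"
      using f F(2) x assms(1) by (auto simp: dist_norm norm_minus_commute intro: subspace_diff)
    then have "f + (x - f) \<in> F + W \<inter> cball 0 r"
      using f(1) by blast
    then show ?thesis
      by simp
  qed
  then show ?thesis
    unfolding finitely_covered_def using F(1) by blast
qed

lemma approximate_subgroup_subspace_cball:
  fixes W :: "'a::euclidean_space set"
  assumes "subspace W" "r > 0"
  shows "approximate_subgroup (W \<inter> cball 0 r)"
proof -
  have "W \<inter> cball 0 r = uminus ` (W \<inter> cball 0 r)"
  proof (intro set_eqI iffI)
    fix x assume "x \<in> W \<inter> cball 0 r"
    then have "- x \<in> W \<inter> cball 0 r"
      using assms(1) by (auto intro: subspace_neg)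
    then show "x \<in> uminus ` (W \<inter> cball 0 r)"
      by force
  qed (use assms(1) in \<open>auto intro: subspace_neg\<close>)
  moreover have "(W \<inter> cball 0 r) + (W \<inter> cball 0 r) \<subseteq> W \<inter> cball 0 (r + r)"
    using assms(1) by (auto elim!: set_plus_elim intro: subspace_add
        norm_triangle_mono[of _ r _ r, simplified])
  then have "finitely_covered ((W \<inter> cball 0 r) + (W \<inter> cball 0 r)) (W \<inter> cball 0 r)"
    using subspace_cball_finitely_covered[OF assms] finitely_covered_mono by blast
  ultimately show ?thesis
    using assms unfolding approximate_subgroup_def finitely_covered_def
    by (simp add: subspace_0)
qed

text \<open>\<open>G\<close> is the preimage of a fine lattice of \<open>W\<close> under the orthogonal projection to \<open>W\<close>.\<close>

lemma subgroup_discrete_cocompact_along_subspace: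
  fixes W :: "'a::euclidean_space set"
  assumes "subspace W" "r > 0"
  shows "\<exists>G. 0 \<in> G \<and> (\<forall>x\<in>G. \<forall>y\<in>G. x - y \<in> G) \<and> G + (W \<inter> cball 0 r) = UNIV \<and>
    (\<exists>s>0. G \<inter> W \<inter> ball 0 s \<subseteq> {0})"
proof -
  obtain B where B: "B \<subseteq> W" "pairwise orthogonal B" "\<And>b. b \<in> B \<Longrightarrow> norm b = 1"
    "independent B" "span B = W"
    using orthonormal_basis_subspace[OF assms(1)] by metis
  have fin: "finite B"
    using B(4) by (rule independent_imp_finite)
  \<comment> \<open>The lattice spacing: a cube of side \<open>s\<close> has vectors of norm at most
    \<open>card B * s\<close>, by the triangle inequality. The added 1 covers the case of empty
    \<open>B\<close>.\<close>
  define s where "s = r / (real (card B) + 1)"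
  have s: "s > 0" "real (card B) * s \<le> r"
    using assms(2) by (auto simp: s_def field_simps)
  define G where "G = {x. \<forall>b\<in>B. (x \<bullet> b) / s \<in> \<int>}"
  have "0 \<in> G" "\<forall>x\<in>G. \<forall>y\<in>G. x - y \<in> G"
    by (auto simp: G_def inner_diff_left diff_divide_distrib)
  moreover have "x \<in> G + (W \<inter> cball 0 r)" for x
  proof -
    \<comment> \<open>The remainder of the projection of \<open>x\<close> to \<open>W\<close> modulo
      the lattice, taken coordinate by coordinate.\<close>
    define c where "c = (\<Sum>b\<in>B. (s * frac ((x \<bullet> b) / s)) *\<^sub>R b)"
    have "c \<in> W"
      using B(1) assms(1) by (auto simp: c_def intro!: subspace_sum subspace_scale)
    moreover have "norm c \<le> r"
    proof -
      have "norm c \<le> (\<Sum>b\<in>B. s)"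
        unfolding c_def using s(1) B(3) frac_lt_1
        by (intro sum_norm_le) (auto simp: abs_mult intro: less_imp_le)
      then show ?thesis
        using s(2) by simp
    qed
    moreover have "x - c \<in> G"
      unfolding G_def
    proof (intro CollectI ballI)
      fix b assume b: "b \<in> B"
      have "b' \<bullet> b = (if b' = b then 1 else 0)" if "b' \<in> B" for b'
        using B(2,3) b that by (auto simp: pairwise_def orthogonal_def norm_eq_1)
      then have "c \<bullet> b = (\<Sum>b'\<in>B. if b' = b then s * frac ((x \<bullet> b) / s) else 0)"
        unfolding c_def inner_sum_left by (intro sum.cong) auto
      then have "c \<bullet> b = s * frac ((x \<bullet> b) / s)"
        using b fin by simp
      then have "((x - c) \<bullet> b) / s = of_int \<lfloor>(x \<bullet> b) / s\<rfloor>"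
        using s(1) by (simp add: inner_diff_left diff_divide_distrib frac_def)
      then show "((x - c) \<bullet> b) / s \<in> \<int>"
        by simp
    qed
    ultimately have "(x - c) + c \<in> G + (W \<inter> cball 0 r)"
      by (intro set_plus_intro) auto
    then show ?thesis
      by simp
  qed
  moreover have "x = 0" if x: "x \<in> G" "x \<in> W" "norm x < s" for x
  proof -
    have "x \<bullet> b = 0" if b: "b \<in> B" for b
    proof -
      \<comment> \<open>A coordinate that is an integer multiple of \<open>s\<close> and smaller
        than \<open>s\<close> in absolute value vanishes.\<close>
      have "\<bar>x \<bullet> b\<bar> < s"
        using Cauchy_Schwarz_ineq2[of x b] B(3)[OF b] x(3) by simp
      then have "\<bar>(x \<bullet> b) / s\<bar> < 1"
        using s(1) by simp
      moreover have "(x \<bullet> b) / s \<in> \<int>"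
        using x(1) b by (simp add: G_def)
      ultimately have "(x \<bullet> b) / s = 0"
        by (intro Ints_nonzero_abs_less1)
      then show ?thesis
        using s(1) by simp
    qed
    then have "orthogonal x x"
      using orthogonal_to_span[of x B x] x(2) B(5) by (simp add: orthogonal_def)
    then show ?thesis
      by (simp add: orthogonal_def)
  qed
  then have "G \<inter> W \<inter> ball 0 s \<subseteq> {0}"
    by (auto simp: dist_norm)
  ultimately show ?thesis
    using s(1) by blast
qed

section \<open>Decomposition of a closed approximate subgroup\<close>

theorem proposition1p5:
  fixes \<Lambda> :: "(real ^ 'd) set"
  assumes "closed \<Lambda>" and "approximate_subgroup \<Lambda>"
  shows "\<exists>V\<^sub>o V\<^sub>d \<Lambda>\<^sub>d K\<^sub>e :: (real ^ 'd) set.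
           supplementary_subspaces V\<^sub>o V\<^sub>d \<and>
           \<Lambda>\<^sub>d \<subseteq> V\<^sub>d \<and> approximate_subgroup \<Lambda>\<^sub>d \<and> uniformly_discrete \<Lambda>\<^sub>d \<and>
           K\<^sub>e \<subseteq> V\<^sub>d \<and> approximate_subgroup K\<^sub>e \<and> compact K\<^sub>e \<and>
           commensurable \<Lambda> (V\<^sub>o + \<Lambda>\<^sub>d + K\<^sub>e)"
proof -
  have sym: "\<Lambda> = uminus ` \<Lambda>" and 0: "0 \<in> \<Lambda>" and cov: "finitely_covered (\<Lambda> + \<Lambda>) \<Lambda>"
    using assms(2) by (auto simp: approximate_subgroup_def finitely_covered_def)
  define S where "S = \<Lambda> + \<Lambda>"
  \<comment> \<open>Four copies of \<open>\<Lambda>\<close> leave room to subtract an element of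
    \<open>K\<close>, itself inside \<open>S\<close>, from one of \<open>\<Lambda>\<close>.\<close>
  define T where "T = S + S"
  have neg\<Lambda>: "- x \<in> \<Lambda>" if "x \<in> \<Lambda>" for x
    using sym that by blast
  then have negS: "- x \<in> S" if "x \<in> S" for x
    using uminus_set_plus[of \<Lambda> \<Lambda>] neg\<Lambda> that unfolding S_def by blast
  then have negT: "- x \<in> T" if "x \<in> T" for x
    using uminus_set_plus[of S S] negS that unfolding T_def by blast
  have S0: "0 \<in> S"
    using set_plus_intro[OF 0 0] by (simp add: S_def)
  then have T0: "0 \<in> T"
    using set_plus_intro[OF S0 S0] by (simp add: T_def)
  have ST: "S \<subseteq> T"
    unfolding T_def using S0 by (rule set_zero_plus2)
  have covS: "finitely_covered S \<Lambda>"
    using cov by (simp add: S_def)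
  have covT: "finitely_covered T \<Lambda>"
    unfolding T_def by (rule finitely_covered_sums[OF cov covS covS])
  have near: "\<exists>\<eta>>0. X \<inter> ball 0 \<eta> \<subseteq> S" if "finitely_covered X \<Lambda>" for X
    using finitely_covered_near_0[OF assms(1) sym that] by (simp add: S_def)
  \<comment> \<open>The first two radii make \<open>S\<close> a closed local subgroup. The third
    concerns \<open>T + T\<close>, which contains the differences of points of
    \<open>D\<close>.\<close>
  obtain \<eta>1 where \<eta>1: "\<eta>1 > 0" "closure S \<inter> ball 0 \<eta>1 \<subseteq> S"
    using near finitely_covered_closure[OF covS assms(1)] by blast
  obtain \<eta>2 where \<eta>2: "\<eta>2 > 0" "(S + S) \<inter> ball 0 \<eta>2 \<subseteq> S"
    using near covT unfolding T_def by blast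
  obtain \<eta>3 where \<eta>3: "\<eta>3 > 0" "(T + T) \<inter> ball 0 \<eta>3 \<subseteq> S"
    using near finitely_covered_sums[OF cov covT covT] by blast
  define \<eta> where "\<eta> = min \<eta>1 \<eta>2"
  have "\<eta> > 0" "closure S \<inter> ball 0 \<eta> \<subseteq> S" "(S + S) \<inter> ball 0 \<eta> \<subseteq> S"
    using \<eta>1 \<eta>2 by (auto simp: \<eta>_def)
  then obtain W \<rho> where W: "subspace W" "W \<inter> ball 0 \<eta> \<subseteq> S" "\<rho> > 0" "S \<inter> ball 0 \<rho> \<subseteq> W"
    using closed_local_subgroup[of \<eta> S] S0 negS by blast
  \<comment> \<open>The halved radius places the closed ball inside the open ball of radius
    \<open>\<eta>\<close>, where \<open>W\<close> lies in \<open>S\<close>.\<close>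
  define K where "K = W \<inter> cball 0 (\<eta> / 2)"
  have KS: "K \<subseteq> S"
    using W(2) \<open>\<eta> > 0\<close> by (auto simp: K_def)
  have negK: "- x \<in> K" if "x \<in> K" for x
    using that W(1) by (auto simp: K_def intro: subspace_neg)
  obtain G s where G: "0 \<in> G" "\<And>x y. x \<in> G \<Longrightarrow> y \<in> G \<Longrightarrow> x - y \<in> G" "G + K = UNIV"
    and s: "s > 0" "G \<inter> W \<inter> ball 0 s \<subseteq> {0}"
    using subgroup_discrete_cocompact_along_subspace[OF W(1), of "\<eta> / 2"] \<open>\<eta> > 0\<close>
    unfolding K_def by auto
  have negG: "- x \<in> G" if "x \<in> G" for x
    using G(2)[OF G(1) that] by simp
  define D where "D = T \<inter> G"

  have "approximate_subgroup D"
  proof -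
    have "D = uminus ` D"
      using negT negG by (force simp: D_def image_iff)
    moreover have "0 \<in> D"
      by (simp add: D_def T0 G(1))
    moreover have "D + D \<subseteq> (T + T) \<inter> G"
    proof
      fix z assume "z \<in> D + D"
      then obtain x y where xy: "z = x + y" "x \<in> D" "y \<in> D"
        by (blast elim: set_plus_elim)
      have "x - - y \<in> G"
        using xy negG by (intro G(2)) (auto simp: D_def)
      then show "z \<in> (T + T) \<inter> G"
        using xy by (auto simp: D_def)
    qed
    \<comment> \<open>Covering by \<open>\<Lambda>\<close> itself, rather than by \<open>T\<close>,
      limits the growth to \<open>\<Lambda> - \<Lambda> = S\<close>, which is still inside
      \<open>T\<close>.\<close>
    moreover have "finitely_covered ((T + T) \<inter> G) ((\<Lambda> + uminus ` \<Lambda>) \<inter> G)"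
      by (rule finitely_covered_Int_subgroup[OF finitely_covered_sums[OF cov covT covT] G(2)])
    moreover have "(\<Lambda> + uminus ` \<Lambda>) \<inter> G \<subseteq> D"
      using ST unfolding sym[symmetric] D_def S_def by blast
    ultimately show ?thesis
      unfolding approximate_subgroup_def
      by (metis finitely_covered_def finitely_covered_mono)
  qed

  moreover have "uniformly_discrete D"
  proof -
    let ?X = "{x - y |x y. x \<in> D \<and> y \<in> D}"
    \<comment> \<open>Successively, \<open>\<eta>3\<close> forces a short difference into
      \<open>S\<close>, \<open>\<rho>\<close> into \<open>W\<close>, and \<open>s\<close> makes it 0
      since it also lies in \<open>G\<close>.\<close>
    define \<epsilon> where "\<epsilon> = min \<eta>3 (min \<rho> s)"
    have small: "z = 0" if z: "z \<in> ?X" "norm z < \<epsilon>" for z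
    proof -
      obtain x y where xy: "z = x - y" "x \<in> D" "y \<in> D"
        using z(1) by blast
      have "x + - y \<in> T + T"
        using xy negT by (intro set_plus_intro) (auto simp: D_def)
      then have "z \<in> S"
        using \<eta>3(2) z(2) xy(1) by (auto simp: \<epsilon>_def)
      then have "z \<in> W"
        using W(4) z(2) by (auto simp: \<epsilon>_def)
      moreover have "z \<in> G"
        using xy G(2) by (auto simp: D_def)
      ultimately show "z = 0"
        using s(2) z(2) by (auto simp: \<epsilon>_def)
    qed
    have X0: "0 \<in> ?X"
      using T0 G(1) by (force simp: D_def)
    have "\<epsilon> > 0"
      using \<eta>3(1) W(3) s(1) by (simp add: \<epsilon>_def)
    have "ball 0 \<epsilon> \<inter> ?X = {0}"
    proof
      show "ball 0 \<epsilon> \<inter> ?X \<subseteq> {0}"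
        using small by (simp add: subset_iff)
      show "{0} \<subseteq> ball 0 \<epsilon> \<inter> ?X"
        using X0 \<open>\<epsilon> > 0\<close> by (simp only: centre_in_ball insert_subset Int_iff) simp
    qed
    with X0 show ?thesis
      unfolding uniformly_discrete_def isolated_in_def by (intro conjI exI[of _ "ball 0 \<epsilon>"] open_ball)
  qed

  moreover have "approximate_subgroup K"
    unfolding K_def using W(1) \<open>\<eta> > 0\<close> by (intro approximate_subgroup_subspace_cball) auto

  moreover have "compact K"
    unfolding K_def using W(1) by (simp add: closed_Int_compact closed_subspace)

  moreover have "commensurable \<Lambda> (D + K)"
  proof -
    have "\<Lambda> \<subseteq> D + K"
    proof
      fix x assume x: "x \<in> \<Lambda>"
      obtain g k where gk: "x = g + k" "g \<in> G" "k \<in> K"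
        using G(3) by (metis UNIV_I set_plus_elim)
      have "x \<in> S"
        using x set_plus_intro[OF x 0] by (simp add: S_def)
      then have "x + - k \<in> T"
        using gk(3) negK KS unfolding T_def by (intro set_plus_intro) auto
      then have "g \<in> D"
        using gk by (simp add: D_def)
      then show "x \<in> D + K"
        using gk by auto
    qed
    moreover have "D + K \<subseteq> T + S"
      unfolding D_def using KS by (intro set_plus_mono2) auto
    then have "finitely_covered (D + K) \<Lambda>"
      by (rule finitely_covered_mono[OF finitely_covered_sums[OF cov covT covS] _ order_refl])
    then obtain F where F: "finite F" "D + K \<subseteq> F + \<Lambda>"
      unfolding finitely_covered_def by blast
    moreover have "D + K \<subseteq> insert 0 F + (D + K)" "F + \<Lambda> \<subseteq> insert 0 F + \<Lambda>"
      by (auto intro: set_zero_plus2[THEN subsetD] set_plus_mono2[THEN subsetD])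
    ultimately show ?thesis
      \<comment> \<open>Adjoining 0 lets one finite set serve both inclusions.\<close>
      unfolding commensurable_def by (intro exI[of _ "insert 0 F"]) auto
  qed

  moreover have "supplementary_subspaces {0} (UNIV :: (real ^ 'd) set)"
    by (auto simp: supplementary_subspaces_def set_plus_def)

  ultimately show ?thesis
    by (intro exI[of _ "{0}"] exI[of _ UNIV] exI[of _ D] exI[of _ K]) simp
qed

end
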